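(* Let $P,a,b,\mathcal{X},\mathcal{U},F,\mathcal{S}$ be as described in the context, with all standing assumptions there. Consider the pseudo-gradient dynamics $$\dot x(t)=\Pi_{\mathcal{X}}\big(x(t),-F(x(t))+u(t)\big).$$ Let $x_s\in\mathcal{S}$ and consider the dynamic intervention $$\dot u(t)=\Pi_{\mathcal{U}}\big(u(t),x_s-x(t)\big).$$ Then, for any initial condition $x(0)\in\mathcal{X}$ (and any $u(0)\in\mathcal{U}$), this intervention protocol steers the action profile $x(t)$ to the point $x_s$, i.e. $\lim_{t\to\infty}x(t)=x_s$.
   Context: Setting. $\mathcal{I}=\{1,\dots,n\}$; $P\in\mathbb{R}^{n\times n}$ with $P_{ij}\in[0,1]$ and $P_{ii}=0$; $a\in\mathbb{R}\setminus\{0\}$; $b\in\mathbb{R}^n$; $\mathcal{X}=\prod_{i\in\mathcal{I}}\mathcal{X}_i$ with $\mathcal{X}_i\subseteq\mathbb{R}$; $\mathcal{U}\subseteq\mathbb{R}^n$ (the intervention set). Notation. For a nonempty closed convex set $\mathcal{C}\subseteq\mathbb{R}^n$ and $x\in\mathcal{C}$, $\mathcal{T}_{\mathcal{C}}(x)=\mathrm{cl}\big(\bigcup_{y\in\mathcal{C}}\bigcup_{\lambda>0}\lambda(y-x)\big)$ is the tangent cone, and $\Pi_{\mathcal{C}}(x,z)$ is the Euclidean projection of $z$ onto $\mathcal{T}_{\mathcal{C}}(x)$. For a map $G:\mathcal{X}\to\mathbb{R}^n$, $\mathrm{SOL}(\mathcal{X},G)$ is the set of $\bar x\in\mathcal{X}$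 with $(x-\bar x)^\top G(\bar x)\ge 0$ for all $x\in\mathcal{X}$; when it is a singleton it is identified with its element. Solutions of the differential equations are Carathéodory: absolutely continuous maps $(x,u):[0,\infty)\to\mathcal{X}\times\mathcal{U}$ satisfying the equations for almost all $t\ge 0$. Maps and sets. $F(x)=(I-aP)x-b$, $H(x)=\big(I-a(P+P^\top)\big)x-b$, and $\mathcal{S}:=\{\bar x\in\mathcal{X}:\exists\,\bar u\in\mathcal{U}\text{ such that }\bar x=\mathrm{SOL}(\mathcal{X},F-\bar u)\}$. Standing assumptions. (1) Each $\mathcal{X}_i$ and $\mathcal{U}$ are nonempty, closed and convex, and $\bm{0}\in\mathcal{U}$. (2) $\max_{i\in\mathcal{I}}a\,\lambda_i(P+P^\top)<1$, where $\lambda_i(\cdot)$ are the eigenvalues. Under (1),(2) the social optimum $x_{\mathrm{opt}}$ is defined as the unique element of $\mathrm{SOL}(\mathcal{X},H)$. (3) $x_{\mathrm{opt}}\in\mathcal{S}$. *)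

theory Defs
  imports "HOL-Analysis.Analysis"
begin

definition eigenvalues :: "real ^ 'n ^ 'n \<Rightarrow> real set" where
  "eigenvalues A = {l. \<exists>v. v \<noteq> 0 \<and> A *v v = l *\<^sub>R v}"

text \<open>The set of real eigenvalues of a symmetric matrix is finite and nonempty, so that
  \<open>Max\<close> is meaningful on it (and on its image under \<open>\<lambda>l. a * l\<close>).\<close>

lemma symmetric_inner:
  fixes A :: "real ^ 'n ^ 'n"
  assumes "transpose A = A"
  shows "x \<bullet> (A *v y) = (A *v x) \<bullet> y"
  by (metis assms dot_lmul_matrix transpose_matrix_vector)

lemma finite_eigenvalues:
  fixes A :: "real ^ 'n ^ 'n"
  assumes "transpose A = A"
  shows "finite (eigenvalues A)"
proof -
  define f where "f l = (SOME v. v \<noteq> 0 \<and> A *v v = l *\<^sub>R v)" for l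
  have f: "f l \<noteq> 0 \<and> A *v f l = l *\<^sub>R f l" if "l \<in> eigenvalues A" for l
    using that unfolding eigenvalues_def f_def mem_Collect_eq by (rule someI_ex)
  have orth: "f k \<bullet> f l = 0" if "k \<in> eigenvalues A" "l \<in> eigenvalues A" "k \<noteq> l" for k l
  proof -
    have "f k \<bullet> (A *v f l) = (A *v f k) \<bullet> f l"
      by (rule symmetric_inner[OF assms])
    then have "l * (f k \<bullet> f l) = k * (f k \<bullet> f l)"
      using f that by simp
    with \<open>k \<noteq> l\<close> show ?thesis by simp
  qed
  have inj: "inj_on f (eigenvalues A)"
    using orth f by (metis inj_onI inner_eq_zero_iff)
  have "pairwise orthogonal (f ` eigenvalues A)"
    unfolding pairwise_def orthogonal_def using orth by blast
  moreover have "0 \<notin> f ` eigenvalues A"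
    using f by force
  ultimately have "independent (f ` eigenvalues A)"
    by (rule pairwise_orthogonal_independent)
  then have "finite (f ` eigenvalues A)"
    using independent_bound by blast
  with inj show ?thesis by (simp add: finite_image_iff)
qed

lemma eigenvalues_nonempty:
  fixes A :: "real ^ 'n ^ 'n"
  assumes sym: "transpose A = A"
  shows "eigenvalues A \<noteq> {}"
proof -
  have "continuous_on (sphere 0 1) (\<lambda>x. x \<bullet> (A *v x))"
    by (intro continuous_intros linear_continuous_on linear_linear[THEN iffD2] matrix_vector_mul_linear)
  moreover have "sphere (0::real^'n) 1 \<noteq> {}"
    by simp
  ultimately obtain v where v: "v \<in> sphere 0 1"
    and vmax: "\<And>x. x \<in> sphere 0 1 \<Longrightarrow> x \<bullet> (A *v x) \<le> v \<bullet> (A *v v)"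
    using continuous_attains_sup[OF compact_sphere] by blast
  define l where "l = v \<bullet> (A *v v)"
  define q where "q x = l *\<^sub>R x - A *v x" for x
  have nv: "v \<bullet> v = 1" using v by (simp add: dot_square_norm)
  have psd: "0 \<le> x \<bullet> q x" for x
  proof (cases "x = 0")
    case False
    define y where "y = x /\<^sub>R norm x"
    have xy: "x = norm x *\<^sub>R y" using False by (simp add: y_def)
    have "y \<in> sphere 0 1" using False by (simp add: y_def)
    then have "y \<bullet> (A *v y) \<le> l" and "y \<bullet> y = 1"
      using vmax by (auto simp: l_def dot_square_norm)
    then have "0 \<le> y \<bullet> q y" by (simp add: q_def inner_diff_right)
    then have "0 \<le> norm x * (norm x * (y \<bullet> q y))" by simp
    also have "\<dots> = (norm x *\<^sub>R y) \<bullet> q (norm x *\<^sub>R y)"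
      by (simp add: q_def algebra_simps matrix_vector_mult_scaleR)
    finally show ?thesis using xy by simp
  qed (simp add: q_def)
  have vq: "v \<bullet> q v = 0" by (simp add: q_def inner_diff_right nv l_def)
  have "q v = 0"
  proof (rule ccontr)
    assume nz: "q v \<noteq> 0"
    let ?w = "q v"
    define c where "c = ?w \<bullet> ?w"
    define d where "d = ?w \<bullet> q ?w"
    have c: "c > 0" using nz by (simp add: c_def)
    have d: "d \<ge> 0" by (simp add: d_def psd)
    have lin: "q (v - t *\<^sub>R ?w) = q v - t *\<^sub>R q ?w" for t
      by (simp add: q_def algebra_simps matrix_vector_mult_scaleR matrix_vector_mult_diff_distrib)
    have sq: "v \<bullet> q ?w = c"
    proof -
      have "v \<bullet> q y = q v \<bullet> y" for y
        by (simp add: q_def inner_diff_right inner_diff_left symmetric_inner[OF sym])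
      then show ?thesis by (simp add: c_def)
    qed
    have expand: "(v - t *\<^sub>R ?w) \<bullet> q (v - t *\<^sub>R ?w) = t * (t * d - 2 * c)" for t
      unfolding lin using vq sq
      by (simp add: inner_diff_left inner_diff_right algebra_simps flip: c_def d_def)
    define t where "t = c / (d + 1)"
    have t: "t > 0" using c d by (simp add: t_def)
    have "t * d \<le> c" using c d by (simp add: t_def field_simps)
    then have "t * d - 2 * c < 0" using c by simp
    then have "t * (t * d - 2 * c) < 0" using t by (simp add: mult_pos_neg)
    with psd[of "v - t *\<^sub>R ?w"] show False unfolding expand by simp
  qed
  then have "A *v v = l *\<^sub>R v" by (simp add: q_def)
  moreover have "v \<noteq> 0" using nv by auto
  ultimately show ?thesis unfolding eigenvalues_def by blast
qed

definition tangent_cone :: "(real ^ 'n) set \<Rightarrow> real ^ 'n \<Rightarrow> (real ^ 'n) set" where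
  "tangent_cone C x = closure (\<Union>y\<in>C. \<Union>l\<in>{0<..}. {l *\<^sub>R (y - x)})"

definition tangent_proj :: "(real ^ 'n) set \<Rightarrow> real ^ 'n \<Rightarrow> real ^ 'n \<Rightarrow> real ^ 'n" where
  "tangent_proj C x z = closest_point (tangent_cone C x) z"

definition SOL :: "(real ^ 'n) set \<Rightarrow> (real ^ 'n \<Rightarrow> real ^ 'n) \<Rightarrow> (real ^ 'n) set" where
  "SOL X G = {xbar \<in> X. \<forall>x\<in>X. (x - xbar) \<bullet> G xbar \<ge> 0}"

definition action_space :: "('n \<Rightarrow> real set) \<Rightarrow> (real ^ 'n) set" where
  "action_space Xi = {x. \<forall>i. x $ i \<in> Xi i}"

definition F_map :: "real ^ 'n ^ 'n \<Rightarrow> real \<Rightarrow> real ^ 'n \<Rightarrow> real ^ 'n \<Rightarrow> real ^ 'n" where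
  "F_map P a b x = (mat 1 - a *\<^sub>R P) *v x - b"

definition H_map :: "real ^ 'n ^ 'n \<Rightarrow> real \<Rightarrow> real ^ 'n \<Rightarrow> real ^ 'n \<Rightarrow> real ^ 'n" where
  "H_map P a b x = (mat 1 - a *\<^sub>R (P + transpose P)) *v x - b"

definition social_optimum ::
    "real ^ 'n ^ 'n \<Rightarrow> real \<Rightarrow> real ^ 'n \<Rightarrow> (real ^ 'n) set \<Rightarrow> real ^ 'n" where
  "social_optimum P a b X = (THE x. x \<in> SOL X (H_map P a b))"

definition steerable_set ::
    "real ^ 'n ^ 'n \<Rightarrow> real \<Rightarrow> real ^ 'n \<Rightarrow> (real ^ 'n) set \<Rightarrow> (real ^ 'n) set \<Rightarrow> (real ^ 'n) set" where
  "steerable_set P a b X U =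
     {xbar \<in> X. \<exists>ubar\<in>U. SOL X (\<lambda>x. F_map P a b x - ubar) = {xbar}}"

text \<open>Absolute continuity of a function on a real interval; \<open>I\<close> ranges over the finite
  families of nonoverlapping compact subintervals \<open>{l..r}\<close> of \<open>S\<close>.\<close>

definition absolutely_continuous_on :: "real set \<Rightarrow> (real \<Rightarrow> 'a::metric_space) \<Rightarrow> bool" where
  "absolutely_continuous_on S f \<longleftrightarrow>
     (\<forall>e>0. \<exists>d>0. \<forall>I :: (real \<times> real) set.
        finite I \<and> (\<forall>(l, r)\<in>I. l < r \<and> {l..r} \<subseteq> S) \<and>
        disjoint_family_on (\<lambda>(l, r). {l<..<r}) I \<and> (\<Sum>(l, r)\<in>I. r - l) < d
        \<longrightarrow> (\<Sum>(l, r)\<in>I. dist (f l) (f r)) < e)"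

text \<open>Absolute continuity of a trajectory on the unbounded interval \<open>{0..}\<close> is, as usual for
  Caratheodory solutions, required on every compact interval \<open>{0..T}\<close>. This is weaker than
  \<open>absolutely_continuous_on {0..}\<close>.\<close>

definition caratheodory_solution ::
    "(real ^ 'n ^ 'n) \<Rightarrow> real \<Rightarrow> real ^ 'n \<Rightarrow> (real ^ 'n) set \<Rightarrow> (real ^ 'n) set \<Rightarrow> real ^ 'n
      \<Rightarrow> (real \<Rightarrow> real ^ 'n) \<Rightarrow> (real \<Rightarrow> real ^ 'n) \<Rightarrow> bool" where
  "caratheodory_solution P a b X U xs x u \<longleftrightarrow>
     (\<forall>t\<ge>0. x t \<in> X \<and> u t \<in> U) \<and>
     (\<forall>T\<ge>0. absolutely_continuous_on {0..T} (\<lambda>t. (x t, u t))) \<and>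
     (AE t in lebesgue. t \<ge> 0 \<longrightarrow>
        (x has_vector_derivative tangent_proj X (x t) (- F_map P a b (x t) + u t))
          (at t within {0..}) \<and>
        (u has_vector_derivative tangent_proj U (u t) (xs - x t)) (at t within {0..}))"

end

theory Submission
  imports Defs
begin

text \<open>Let \<open>ub \<in> U\<close> be a constant intervention for which \<open>xs\<close> solves the variational inequality, and
  put \<open>V = \<bar>x - xs\<bar>\<^sup>2 + \<bar>u - ub\<bar>\<^sup>2\<close>. Projecting onto a tangent cone only decreases the inner product
  with a vector pointing away from the set, so in \<open>V'\<close> the two projections can be dropped; the cross
  terms in \<open>x - xs\<close> and \<open>u - ub\<close> then cancel, and the spectral condition makes \<open>F\<close> strongly monotone
  with constant \<open>1/2\<close>, which leaves \<open>V' \<le> - \<bar>x - xs\<bar>\<^sup>2\<close> almost everywhere. Hence the trajectory is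
  bounded, so \<open>x\<close> is Lipschitz, and every visit of \<open>x\<close> to distance \<open>e\<close> from \<open>xs\<close> costs a fixed amount
  of \<open>V \<ge> 0\<close>: such visits cannot recur forever (Barbalat's argument).\<close>

subsection \<open>Projection onto tangent cones\<close>

text \<open>The rays from \<open>x\<close> through points of a convex \<open>C\<close> are closed
  under sums and positive multiples, and both survive the closure. The last claim makes
  \<open>p + (y - x)\<close> admissible as a comparison point for a projection
  \<open>p\<close>.\<close>

lemma tangent_cone_convex_cone:
  fixes C :: "(real ^ 'n) set"
  assumes "convex C" "y \<in> C" "x \<in> C"
  shows "closed (tangent_cone C x)" "convex (tangent_cone C x)" "0 \<in> tangent_cone C x"
    "p \<in> tangent_cone C x \<Longrightarrow> p + (y - x) \<in> tangent_cone C x"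
proof -
  define K where "K = (\<Union>y\<in>C. \<Union>l\<in>{0<..}. {l *\<^sub>R (y - x)})"
  have T: "tangent_cone C x = closure K"
    by (simp add: tangent_cone_def K_def)
  have mem: "v \<in> K \<longleftrightarrow> (\<exists>l>0. \<exists>y\<in>C. v = l *\<^sub>R (y - x))" for v
    unfolding K_def by auto
  have Kadd: "v + w \<in> K" if vw: "v \<in> K" "w \<in> K" for v w
  proof -
    obtain l m y z where lm: "l > 0" "m > 0" "y \<in> C" "z \<in> C"
      "v = l *\<^sub>R (y - x)" "w = m *\<^sub>R (z - x)"
      using vw unfolding mem by blast
    \<comment> \<open>The weights make \<open>v + w\<close> the multiple \<open>l + m\<close> of the
      single direction \<open>?q - x\<close>.\<close>
    let ?q = "(l / (l + m)) *\<^sub>R y + (m / (l + m)) *\<^sub>R z"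
    have "?q \<in> C"
      using lm by (intro convexD[OF \<open>convex C\<close>]) (auto simp flip: add_divide_distrib)
    moreover have "v + w = (l + m) *\<^sub>R (?q - x)"
      using lm by (simp add: scaleR_add_right scaleR_diff_right scaleR_add_left)
    ultimately show ?thesis
      unfolding mem using lm by (intro exI[of _ "l + m"]) auto
  qed
  have Kscale: "c *\<^sub>R v \<in> K" if "v \<in> K" "c > 0" for c v
    using that unfolding mem by (metis mult_pos_pos scaleR_scaleR)
  have Kdir: "y - x \<in> K"
    using assms unfolding mem by (metis scaleR_one zero_less_one)
  have "convex K"
  proof (rule convexI)
    fix v w :: "real^'n" and s t :: real
    assume "v \<in> K" "w \<in> K" "0 \<le> s" "0 \<le> t" "s + t = 1"
    then show "s *\<^sub>R v + t *\<^sub>R w \<in> K"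
      by (cases "s = 0"; cases "t = 0") (simp_all add: Kadd Kscale)
  qed
  then show "closed (tangent_cone C x)" "convex (tangent_cone C x)"
    by (auto simp: T convex_closure)
  have "0 \<in> K"
    using assms unfolding mem by (intro exI[of _ 1]) auto
  then show "0 \<in> tangent_cone C x"
    using closure_subset by (auto simp: T)
  show "p + (y - x) \<in> tangent_cone C x" if "p \<in> tangent_cone C x"
  proof -
    \<comment> \<open>Translation by \<open>y - x\<close> is continuous and maps \<open>K\<close>
      into itself, hence also the closure.\<close>
    have "(\<lambda>v. v + (y - x)) ` closure K \<subseteq> closure K"
    proof (rule image_closure_subset)
      show "(\<lambda>v. v + (y - x)) ` K \<subseteq> closure K"
        using Kadd Kdir closure_subset by blast
    qed (auto intro!: continuous_intros)
    then show ?thesis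
      using that T by auto
  qed
qed

text \<open>The variational inequality of the projection \<open>p\<close> onto the cone, tested at
  \<open>p + (y - x)\<close>. With \<open>y\<close> an equilibrium value, it removes the projections
  from the derivative of the Lyapunov function.\<close>

lemma tangent_proj_obtuse:
  assumes "convex C" "y \<in> C" "x \<in> C"
  shows "(x - y) \<bullet> tangent_proj C x z \<le> (x - y) \<bullet> z"
proof -
  note tc = tangent_cone_convex_cone[OF assms]
  let ?p = "tangent_proj C x z"
  have "?p \<in> tangent_cone C x"
    unfolding tangent_proj_def using tc(1,3) by (intro closest_point_in_set) auto
  then have "(z - ?p) \<bullet> ((?p + (y - x)) - ?p) \<le> 0"
    unfolding tangent_proj_def by (intro closest_point_dot tc) (simp add: tangent_proj_def)
  then show ?thesis
    by (simp add: inner_diff_left inner_diff_right inner_commute)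
qed

text \<open>Testing the projection's variational inequality at the apex \<open>0\<close> and
  applying Cauchy-Schwarz suffices. This bounds the speed of the trajectory.\<close>

lemma norm_tangent_proj_le:
  assumes "convex C" "x \<in> C"
  shows "norm (tangent_proj C x z) \<le> norm z"
proof -
  note tc = tangent_cone_convex_cone[OF assms(1,2,2)]
  let ?p = "tangent_proj C x z"
  have "(z - ?p) \<bullet> (0 - ?p) \<le> 0"
    unfolding tangent_proj_def by (intro closest_point_dot tc)
  then have "norm ?p * norm ?p \<le> z \<bullet> ?p"
    by (simp add: inner_diff_left power2_eq_square flip: power2_norm_eq_inner)
  also have "\<dots> \<le> norm z * norm ?p"
    by (rule norm_cauchy_schwarz)
  finally show ?thesis
    by (cases "?p = 0") auto
qed

subsection \<open>Strong monotonicity of the pseudo-gradient\<close>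

text \<open>A maximizer of the quadratic form on the unit sphere is an eigenvector, and the maximum
  is its eigenvalue; homogeneity carries the bound from the sphere to all vectors.\<close>

lemma symmetric_rayleigh_eigenvalue:
  fixes A :: "real ^ 'n ^ 'n"
  assumes sym: "transpose A = A"
  obtains l where "l \<in> eigenvalues A" "\<And>x. x \<bullet> (A *v x) \<le> l * (x \<bullet> x)"
proof -
  have "continuous_on (sphere 0 1) (\<lambda>x. x \<bullet> (A *v x))"
    by (intro continuous_intros linear_continuous_on linear_linear[THEN iffD2]
          matrix_vector_mul_linear)
  moreover have "sphere (0::real^'n) 1 \<noteq> {}"
    by simp
  ultimately have "\<exists>v\<in>sphere 0 1. \<forall>x\<in>sphere 0 1. x \<bullet> (A *v x) \<le> v \<bullet> (A *v v)"
    by (intro continuous_attains_sup compact_sphere)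
  then obtain v where v: "norm v = 1"
    and vmax: "\<And>x. norm x = 1 \<Longrightarrow> x \<bullet> (A *v x) \<le> v \<bullet> (A *v v)"
    unfolding Bex_def Ball_def mem_sphere_0 by blast
  define l where "l = v \<bullet> (A *v v)"
  have ray: "x \<bullet> (A *v x) \<le> l * (x \<bullet> x)" for x
  proof (cases "x = 0")
    case False
    define y where "y = x /\<^sub>R norm x"
    have "norm y = 1" and x: "x = norm x *\<^sub>R y"
      using False by (simp_all add: y_def)
    then have "y \<bullet> (A *v y) \<le> l"
      unfolding l_def by (intro vmax)
    then have "(norm x)\<^sup>2 * (y \<bullet> (A *v y)) \<le> (norm x)\<^sup>2 * l"
      by (intro mult_left_mono) auto
    also have "(norm x)\<^sup>2 * (y \<bullet> (A *v y)) = x \<bullet> (A *v x)"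
      by (subst (2 3) x) (simp add: matrix_vector_mult_scaleR power2_eq_square)
    finally show ?thesis
      by (simp add: power2_norm_eq_inner mult.commute)
  qed simp
  have vv: "v \<bullet> v = 1"
    using v by (simp add: dot_square_norm)
  \<comment> \<open>The quadratic form of \<open>l I - A\<close> is nonnegative and vanishes at \<open>v\<close>, so its gradient
    vanishes there.\<close>
  have crit: "w \<bullet> (l *\<^sub>R v - A *v v) = 0" for w
  proof -
    define g where "g t = l * ((v + t *\<^sub>R w) \<bullet> (v + t *\<^sub>R w))
        - (v + t *\<^sub>R w) \<bullet> (A *v (v + t *\<^sub>R w))" for t :: real
    have g: "g t = 2 * t * (w \<bullet> (l *\<^sub>R v - A *v v)) + t^2 * (l * (w \<bullet> w) - w \<bullet> (A *v w))" for t
      using symmetric_inner[OF sym, of v w] vv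
      by (simp add: g_def l_def matrix_vector_right_distrib matrix_vector_mult_scaleR
          inner_add_left inner_add_right inner_diff_right inner_commute power2_eq_square
          algebra_simps)
    have "DERIV g 0 :> 2 * (w \<bullet> (l *\<^sub>R v - A *v v))"
      unfolding g by (auto intro!: derivative_eq_intros)
    moreover have "g 0 \<le> g t" for t
      using ray[of "v + t *\<^sub>R w"] g[of 0] by (simp add: g_def)
    ultimately have "2 * (w \<bullet> (l *\<^sub>R v - A *v v)) = 0"
      by (intro DERIV_local_min[of g _ 0 1]) auto
    then show ?thesis by simp
  qed
  have "A *v v = l *\<^sub>R v"
    using crit[of "l *\<^sub>R v - A *v v"] by simp
  moreover have "v \<noteq> 0"
    using v by auto
  ultimately have "l \<in> eigenvalues A"
    unfolding eigenvalues_def by blast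
  with ray that show thesis by blast
qed

text \<open>A matrix and its transpose have the same quadratic form, so for \<open>z = x - y\<close>
  the left factor is \<open>z \<bullet> z\<close> minus half the form of
  \<open>a *\<^sub>R (P + transpose P)\<close>, which is at most
  \<open>z \<bullet> z\<close>.\<close>

lemma F_map_strongly_monotone:
  fixes P :: "real ^ 'n ^ 'n"
  assumes "a \<noteq> 0" and "Max ((\<lambda>l. a * l) ` eigenvalues (P + transpose P)) < 1"
  shows "(x - y) \<bullet> (F_map P a b x - F_map P a b y) \<ge> (norm (x - y))\<^sup>2 / 2"
proof -
  let ?A = "P + transpose P"
  have symA: "transpose ?A = ?A"
    by (simp add: transpose_def vec_eq_iff)
  \<comment> \<open>Taking the top eigenvalue after scaling by \<open>a\<close> avoids a case split
    on the sign of \<open>a\<close>.\<close>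
  then have "transpose (a *\<^sub>R ?A) = a *\<^sub>R ?A"
    by (simp add: transpose_def vec_eq_iff)
  then obtain l where l: "l \<in> eigenvalues (a *\<^sub>R ?A)"
    and ray: "\<And>z. z \<bullet> ((a *\<^sub>R ?A) *v z) \<le> l * (z \<bullet> z)"
    by (rule symmetric_rayleigh_eigenvalue) blast
  from l obtain v where "v \<noteq> 0" and v: "(a *\<^sub>R ?A) *v v = l *\<^sub>R v"
    unfolding eigenvalues_def by blast
  have "?A *v v = (1 / a) *\<^sub>R ((a *\<^sub>R ?A) *v v)"
    using \<open>a \<noteq> 0\<close> by (simp add: scaleR_matrix_vector_assoc[symmetric])
  then have "l / a \<in> eigenvalues ?A"
    using \<open>v \<noteq> 0\<close> unfolding eigenvalues_def v by (auto intro!: exI[of _ v])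
  then have "a * (l / a) \<le> Max ((\<lambda>l. a * l) ` eigenvalues ?A)"
    by (intro Max_ge finite_imageI finite_eigenvalues symA imageI)
  then have "l < 1"
    using assms by simp
  define z where "z = x - y"
  have "z \<bullet> (transpose P *v z) = z \<bullet> (P *v z)"
    by (metis dot_lmul_matrix inner_commute transpose_matrix_vector)
  then have "2 * (a * (z \<bullet> (P *v z))) = z \<bullet> ((a *\<^sub>R ?A) *v z)"
    by (simp add: scaleR_matrix_vector_assoc[symmetric] matrix_vector_mult_add_rdistrib
        inner_add_right)
  also have "\<dots> \<le> l * (z \<bullet> z)"
    by (rule ray)
  also have "\<dots> \<le> 1 * (z \<bullet> z)"
    using \<open>l < 1\<close> by (intro mult_right_mono) auto
  finally have *: "2 * (a * (z \<bullet> (P *v z))) \<le> z \<bullet> z"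
    by simp
  have "F_map P a b x - F_map P a b y = z - a *\<^sub>R (P *v z)"
    by (simp add: F_map_def z_def matrix_vector_mult_diff_rdistrib matrix_vector_mult_diff_distrib
        scaleR_matrix_vector_assoc[symmetric] algebra_simps)
  with * show ?thesis
    by (simp add: inner_diff_right power2_norm_eq_inner flip: z_def)
qed

subsection \<open>Absolutely continuous functions\<close>

definition nonoverlapping_in :: "real set \<Rightarrow> (real \<times> real) set \<Rightarrow> bool" where
  "nonoverlapping_in S I \<longleftrightarrow> finite I \<and> (\<forall>(l, r)\<in>I. l < r \<and> {l..r} \<subseteq> S) \<and>
     disjoint_family_on (\<lambda>(l, r). {l<..<r}) I"

lemma absolutely_continuous_on_iff:
  "absolutely_continuous_on S f \<longleftrightarrow>
    (\<forall>e>0. \<exists>d>0. \<forall>I. nonoverlapping_in S I \<longrightarrow> (\<Sum>(l, r)\<in>I. r - l) < d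
      \<longrightarrow> (\<Sum>(l, r)\<in>I. dist (f l) (f r)) < e)"
  unfolding absolutely_continuous_on_def nonoverlapping_in_def by (simp only: imp_conjL)

lemma absolutely_continuous_on_imp_continuous_on:
  assumes "absolutely_continuous_on {a..b} f"
  shows "continuous_on {a..b} f"
  unfolding continuous_on_iff
proof (intro ballI allI impI)
  fix s and e :: real
  assume s: "s \<in> {a..b}" and "e > 0"
  then obtain d where "d > 0" and d: "\<And>I. nonoverlapping_in {a..b} I \<Longrightarrow>
      (\<Sum>(l, r)\<in>I. r - l) < d \<Longrightarrow> (\<Sum>(l, r)\<in>I. dist (f l) (f r)) < e"
    using assms unfolding absolutely_continuous_on_iff by blast
  have step: "dist (f l) (f r) < e" if "l < r" "l \<in> {a..b}" "r \<in> {a..b}" "r - l < d" for l r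
    using d[of "{(l, r)}"] that by (auto simp: disjoint_family_on_def nonoverlapping_in_def)
  show "\<exists>d>0. \<forall>t\<in>{a..b}. dist t s < d \<longrightarrow> dist (f t) (f s) < e"
  proof (intro exI[of _ d] conjI ballI impI \<open>d > 0\<close>)
    fix t assume t: "t \<in> {a..b}" "dist t s < d"
    consider "t < s" | "t = s" | "t > s" by linarith
    then show "dist (f t) (f s) < e"
      using step[of t s] step[of s t] s t \<open>e > 0\<close>
      by cases (auto simp: dist_real_def dist_commute)
  qed
qed

lemma absolutely_continuous_on_subset:
  assumes "absolutely_continuous_on S f" "T \<subseteq> S"
  shows "absolutely_continuous_on T f"
proof -
  have "nonoverlapping_in S I" if "nonoverlapping_in T I" for I
    using that \<open>T \<subseteq> S\<close> unfolding nonoverlapping_in_def by fast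
  then show ?thesis
    using assms(1) unfolding absolutely_continuous_on_iff by meson
qed

text \<open>Only increments are compared, so this serves components, inner products and squared
  distances along a trajectory alike.\<close>

lemma absolutely_continuous_on_lipschitz_comp:
  assumes ac: "absolutely_continuous_on S f"
    and lip: "\<And>s t. s \<in> S \<Longrightarrow> t \<in> S \<Longrightarrow> dist (h s) (h t) \<le> L * dist (f s) (f t)"
  shows "absolutely_continuous_on S h"
  unfolding absolutely_continuous_on_iff
proof (intro allI impI)
  fix e :: real assume "e > 0"
  \<comment> \<open>\<open>L\<close> may be zero or negative, while \<open>e / K\<close> needs a
    positive divisor.\<close>
  define K where "K = \<bar>L\<bar> + 1"
  have K: "K > 0" "L \<le> K" by (auto simp: K_def)
  then have "e / K > 0" using \<open>e > 0\<close> by simp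
  then obtain d where "d > 0" and d: "\<And>I. nonoverlapping_in S I \<Longrightarrow>
      (\<Sum>(l, r)\<in>I. r - l) < d \<Longrightarrow> (\<Sum>(l, r)\<in>I. dist (f l) (f r)) < e / K"
    using ac unfolding absolutely_continuous_on_iff by blast
  show "\<exists>d>0. \<forall>I. nonoverlapping_in S I \<longrightarrow> (\<Sum>(l, r)\<in>I. r - l) < d
      \<longrightarrow> (\<Sum>(l, r)\<in>I. dist (h l) (h r)) < e"
  proof (intro exI[of _ d] conjI allI impI \<open>d > 0\<close>)
    fix I
    assume I: "nonoverlapping_in S I" "(\<Sum>(l, r)\<in>I. r - l) < d"
    have "dist (h l) (h r) \<le> K * dist (f l) (f r)" if "(l, r) \<in> I" for l r
    proof -
      have "{l..r} \<subseteq> S" "l < r"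
        using I that by (auto simp: nonoverlapping_in_def)
      then have "dist (h l) (h r) \<le> L * dist (f l) (f r)"
        by (intro lip) auto
      also have "\<dots> \<le> K * dist (f l) (f r)"
        using K by (intro mult_right_mono) auto
      finally show ?thesis .
    qed
    then have "(\<Sum>(l, r)\<in>I. dist (h l) (h r)) \<le> (\<Sum>(l, r)\<in>I. K * dist (f l) (f r))"
      by (intro sum_mono) auto
    also have "\<dots> = K * (\<Sum>(l, r)\<in>I. dist (f l) (f r))"
      by (simp add: sum_distrib_left case_prod_unfold)
    also have "\<dots> < K * (e / K)"
      using d[OF I] K by (intro mult_strict_left_mono)
    finally show "(\<Sum>(l, r)\<in>I. dist (h l) (h r)) < e"
      using K by simp
  qed
qed

text \<open>Take a tagged division that is fine for a gauge which, at the tags in the exceptional null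
  set, stays inside an open set of small measure. Absolute continuity bounds the increments over
  those intervals, the derivative bounds the others.\<close>

lemma absolutely_continuous_on_increment_le:
  fixes g :: "real \<Rightarrow> real"
  assumes "a \<le> b" and ac: "absolutely_continuous_on {a..b} g"
    and ae: "AE t in lebesgue. t \<in> {a..b} \<longrightarrow>
      (\<exists>D\<le>M. (g has_vector_derivative D) (at t within {a..b}))"
  shows "g b - g a \<le> M * (b - a)"
proof (rule field_le_epsilon)
  fix e' :: real assume "e' > 0"
  \<comment> \<open>Three errors add up to \<open>e'\<close>: \<open>e * (b - a)\<close> from the
    derivative estimates, \<open>e\<close> from the increments over the exceptional intervals, and
    \<open>e\<close> from their missing length.\<close>
  define e where "e = e' / (b - a + 2)"
  have "e * (b - a + 2) = e'"
    using \<open>a \<le> b\<close> by (simp add: e_def)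
  then have e: "e * (b - a) + e + e = e'" "e > 0"
    using \<open>e' > 0\<close> \<open>a \<le> b\<close> unfolding distrib_left by (linarith, simp add: e_def)
  obtain N where N: "N \<in> null_sets lebesgue"
    and exceptional: "{t \<in> space lebesgue. \<not> (t \<in> {a..b} \<longrightarrow>
      (\<exists>D\<le>M. (g has_vector_derivative D) (at t within {a..b})))} \<subseteq> N"
    using ae unfolding eventually_ae_filter by blast
  then have good: "\<exists>D\<le>M. (g has_vector_derivative D) (at t within {a..b})"
    if "t \<in> {a..b}" "t \<notin> N" for t
    using that by (auto simp: subset_iff)
  obtain d0 where "d0 > 0" and d0: "\<And>I. nonoverlapping_in {a..b} I \<Longrightarrow>
      (\<Sum>(l, r)\<in>I. r - l) < d0 \<Longrightarrow> (\<Sum>(l, r)\<in>I. dist (g l) (g r)) < e"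
    using ac e(2) unfolding absolutely_continuous_on_iff by blast
  \<comment> \<open>If \<open>M < 0\<close>, the length of the exceptional intervals is missing from the bound over the
    others, which costs up to \<open>\<bar>M\<bar> * d\<close>.\<close>
  define d where "d = min d0 (e / (\<bar>M\<bar> + 1))"
  have "d > 0" "d \<le> d0"
    using \<open>d0 > 0\<close> e(2) by (auto simp: d_def)
  have Md: "\<bar>M\<bar> * d \<le> e"
  proof -
    have "\<bar>M\<bar> * d \<le> (\<bar>M\<bar> + 1) * (e / (\<bar>M\<bar> + 1))"
      using \<open>d > 0\<close> by (intro mult_mono) (auto simp: d_def)
    then show ?thesis by simp
  qed
  obtain G where G: "open G" "N \<subseteq> G" "G - N \<in> lmeasurable" "emeasure lebesgue (G - N) < ennreal d"
    using sets_lebesgue_outer_open[OF null_setsD2[OF N] \<open>d > 0\<close>] by blast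
  \<comment> \<open>The approximation bounds only \<open>G - N\<close>; removing the null set
    \<open>N\<close> does not change the measure.\<close>
  have "emeasure lebesgue G = emeasure lebesgue (G - N)"
    using emeasure_Diff_null_set[OF N] G(1) by simp
  then have "emeasure lebesgue G < ennreal d"
    using G(4) by simp
  then have Gmeas: "G \<in> lmeasurable"
    using G(1) by (auto simp: fmeasurable_def intro: less_trans)
  then have Gd: "measure lebesgue G < d"
    using \<open>emeasure lebesgue G < ennreal d\<close> \<open>d > 0\<close>
    by (simp only: emeasure_eq_measure2 ennreal_less_iff measure_nonneg)
  \<comment> \<open>Straddle estimate: as \<open>t\<close> lies between \<open>l\<close> and
    \<open>r\<close>, the linearization errors at the two ends add up to
    \<open>e * (r - l)\<close>.\<close>
  have "\<exists>\<delta>>0. \<forall>l r. t \<in> {l..r} \<longrightarrow> {l..r} \<subseteq> {a..b} \<inter> ball t \<delta> \<longrightarrow>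
      g r - g l \<le> (M + e) * (r - l)" if t: "t \<in> {a..b}" "t \<notin> N" for t
  proof -
    obtain D where "D \<le> M" and D: "(g has_vector_derivative D) (at t within {a..b})"
      using good[OF t] by blast
    obtain \<delta> where "\<delta> > 0" and \<delta>: "\<And>y. y \<in> {a..b} \<Longrightarrow> norm (y - t) < \<delta> \<Longrightarrow>
        norm (g y - g t - (y - t) *\<^sub>R D) \<le> e * norm (y - t)"
      using D e(2) unfolding has_vector_derivative_def has_derivative_within_alt by metis
    have "g r - g l \<le> (M + e) * (r - l)"
      if lr: "t \<in> {l..r}" "{l..r} \<subseteq> {a..b} \<inter> ball t \<delta>" for l r
    proof -
      have "l \<in> {l..r}" "r \<in> {l..r}" using lr by auto
      then have mem: "l \<in> {a..b}" "r \<in> {a..b}" "norm (l - t) < \<delta>" "norm (r - t) < \<delta>"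
        using lr(2) by (auto simp: dist_norm norm_minus_commute)
      have "g r - g t - (r - t) * D \<le> e * (r - t)"
        using \<delta>[of r] mem lr by (simp add: abs_le_iff)
      moreover have "g t - g l + (l - t) * D \<le> e * (t - l)"
        using \<delta>[of l] mem lr by (simp add: abs_le_iff)
      ultimately have "g r - g l \<le> (D + e) * (r - l)"
        by (simp add: algebra_simps)
      also have "\<dots> \<le> (M + e) * (r - l)"
        using \<open>D \<le> M\<close> lr(1) by (intro mult_right_mono) auto
      finally show ?thesis .
    qed
    with \<open>\<delta> > 0\<close> show ?thesis by blast
  qed
  then obtain \<delta> where \<delta>: "\<And>t. t \<in> {a..b} \<Longrightarrow> t \<notin> N \<Longrightarrow> \<delta> t > 0 \<and>
      (\<forall>l r. t \<in> {l..r} \<longrightarrow> {l..r} \<subseteq> {a..b} \<inter> ball t (\<delta> t) \<longrightarrow> g r - g l \<le> (M + e) * (r - l))"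
    by metis
  \<comment> \<open>\<open>UNIV\<close> is a mere default, since all tags lie in
    \<open>{a..b}\<close>.\<close>
  define \<gamma> where "\<gamma> t = (if t \<in> N then G else if t \<in> {a..b} then ball t (\<delta> t) else UNIV)" for t
  have "gauge \<gamma>"
    using G \<delta> by (auto simp: gauge_def \<gamma>_def)
  then obtain p where p: "p tagged_division_of {a..b}" and fine: "\<gamma> fine p"
    by (rule fine_division_exists_real)
  note pD = tagged_division_ofD[OF p]
  have K: "\<exists>l r. K = {l..r} \<and> l \<le> r \<and> Inf K = l \<and> Sup K = r \<and> measure lborel K = r - l"
    if "(t, K) \<in> p" for t K
  proof -
    obtain l r where "K = cbox l r" using pD(4) \<open>(t, K) \<in> p\<close> by blast
    moreover have "t \<in> K" using pD(2) \<open>(t, K) \<in> p\<close> by blast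
    ultimately have "K = {l..r}" "l \<le> r" by auto
    then show ?thesis by auto
  qed
  define B where "B = {(t, K). (t, K) \<in> p \<and> t \<in> N}"
  have "B \<subseteq> p"
    by (auto simp: B_def)
  note B = this finite_subset[OF this pD(1)]
  have Bpart: "B tagged_partial_division_of {a..b}"
    by (rule tagged_partial_division_subset[OF conjunct1[OF p[unfolded tagged_division_of_def]] B(1)])
  \<comment> \<open>Absolute continuity speaks of intervals with \<open>l < r\<close>, so degenerate
    pieces are dropped; their increments vanish.\<close>
  define Q where "Q = {K \<in> snd ` B. measure lborel K \<noteq> 0}"
  define J where "J = (\<lambda>K. (Inf K, Sup K)) ` Q"
  have QD: "\<exists>l r. K = {l..r} \<and> l < r \<and> Inf K = l \<and> Sup K = r \<and> measure lborel K = r - l"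
    "K \<subseteq> {a..b}" "K \<subseteq> G" if "K \<in> Q" for K
  proof -
    obtain t where tK: "(t, K) \<in> p" "t \<in> N" "measure lborel K \<noteq> 0"
      using \<open>K \<in> Q\<close> by (auto simp: Q_def B_def)
    then show "\<exists>l r. K = {l..r} \<and> l < r \<and> Inf K = l \<and> Sup K = r \<and> measure lborel K = r - l"
      using K[OF tK(1)] by force
    show "K \<subseteq> {a..b}" using pD(3) tK(1) by blast
    show "K \<subseteq> G" using fineD[OF fine tK(1)] tK(2) by (simp add: \<gamma>_def)
  qed
  have int: "interior K = {Inf K<..<Sup K}" if K: "K \<in> Q" for K
  proof -
    obtain l r where "K = {l..r}" "Inf K = l" "Sup K = r"
      using QD(1)[OF K] by blast
    then show ?thesis
      by (simp add: interior_atLeastAtMost_real)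
  qed
  have Qdiv: "snd ` B division_of \<Union>(snd ` B)"
    using Bpart by (rule partial_division_of_tagged_division)
  then have Qdiv': "Q division_of \<Union>Q"
    by (rule division_of_subset) (auto simp: Q_def)
  have inj: "inj_on (\<lambda>K. (Inf K, Sup K)) Q"
  proof (rule inj_onI)
    fix K L assume "K \<in> Q" "L \<in> Q" "(Inf K, Sup K) = (Inf L, Sup L)"
    then show "K = L"
      using QD(1)[of K] QD(1)[of L] by auto
  qed
  have sumJ: "(\<Sum>(l, r)\<in>J. h l r) = (\<Sum>K\<in>Q. h (Inf K) (Sup K))" for h :: "real \<Rightarrow> real \<Rightarrow> real"
    by (simp add: J_def sum.reindex[OF inj])
  have contentQ: "(\<Sum>K\<in>Q. measure lborel K) < d"
  proof -
    have "(\<Sum>K\<in>Q. measure lborel K) = (\<Sum>K\<in>Q. measure lebesgue K)"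
    proof (rule sum.cong[OF refl])
      fix K assume "K \<in> Q"
      then have "K \<in> sets lborel"
        using division_ofD(4)[OF Qdiv'] by fastforce
      then show "measure lborel K = measure lebesgue K"
        by (simp add: measure_completion)
    qed
    also have "\<dots> = measure lebesgue (\<Union>Q)"
      by (rule content_division[OF Qdiv'])
    also have "\<dots> \<le> measure lebesgue G"
      using QD(3) Gmeas lmeasurable_division[OF Qdiv']
      by (intro measure_mono_fmeasurable) (auto dest: fmeasurableD)
    finally show ?thesis
      using Gd by simp
  qed
  \<comment> \<open>Different tags can share an interval only if it is degenerate, so summing over
    intervals loses nothing for a summand vanishing there.\<close>
  have "(\<Sum>(t, K)\<in>B. measure lborel K) = (\<Sum>K\<in>snd ` B. measure lborel K)"
    by (rule sum.over_tagged_division_lemma[OF tagged_partial_division_of_Union_self[OF Bpart]])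
      (simp add: content_eq_0_interior)
  also have "\<dots> = (\<Sum>K\<in>Q. measure lborel K)"
    unfolding Q_def using B by (intro sum.mono_neutral_right) auto
  finally have contentB: "(\<Sum>(t, K)\<in>B. measure lborel K) < d"
    using contentQ by simp
  have "(\<Sum>(l, r)\<in>J. dist (g l) (g r)) < e"
  proof (rule d0)
    have "finite J"
      using B by (auto simp: J_def Q_def)
    moreover have "\<forall>(l, r)\<in>J. l < r \<and> {l..r} \<subseteq> {a..b}"
      using QD(1,2) by (fastforce simp: J_def)
    moreover have "disjoint_family_on (\<lambda>(l, r). {l<..<r}) J"
      unfolding disjoint_family_on_def
    proof (intro ballI impI)
      fix y z assume "y \<in> J" "z \<in> J" "y \<noteq> z"
      then obtain K L where KL: "K \<in> Q" "L \<in> Q" "y = (Inf K, Sup K)" "z = (Inf L, Sup L)" "K \<noteq> L"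
        by (auto simp: J_def)
      then have "interior K \<inter> interior L = {}"
        using division_ofD(5)[OF Qdiv'] by blast
      moreover have "interior K = {Inf K<..<Sup K}" "interior L = {Inf L<..<Sup L}"
        using int KL(1,2) by auto
      ultimately show "(case y of (l, r) \<Rightarrow> {l<..<r}) \<inter> (case z of (l, r) \<Rightarrow> {l<..<r}) = {}"
        using KL by simp
    qed
    ultimately show "nonoverlapping_in {a..b} J"
      by (simp add: nonoverlapping_in_def)
    have "(\<Sum>(l, r)\<in>J. r - l) = (\<Sum>K\<in>Q. measure lborel K)"
      unfolding sumJ using QD(1) by (intro sum.cong) fastforce+
    then show "(\<Sum>(l, r)\<in>J. r - l) < d0"
      using contentQ \<open>d \<le> d0\<close> by simp
  qed
  then have bad: "(\<Sum>(t, K)\<in>B. g (Sup K) - g (Inf K)) \<le> e"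
  proof -
    assume J: "(\<Sum>(l, r)\<in>J. dist (g l) (g r)) < e"
    have "(\<Sum>(t, K)\<in>B. g (Sup K) - g (Inf K)) \<le> (\<Sum>(t, K)\<in>B. dist (g (Inf K)) (g (Sup K)))"
      by (intro sum_mono) (auto simp: dist_real_def)
    \<comment> \<open>The case distinction leaves the sum unchanged, but makes the summand zero on
      the empty box too, where \<open>Inf\<close> and \<open>Sup\<close> give no information; the
      next rule demands this.\<close>
    also have "\<dots> = (\<Sum>(t, K)\<in>B. if measure lborel K = 0 then 0 else dist (g (Inf K)) (g (Sup K)))"
      using B(1) K by (intro sum.cong) fastforce+
    also have "\<dots> = (\<Sum>K\<in>snd ` B. if measure lborel K = 0 then 0 else dist (g (Inf K)) (g (Sup K)))"
      by (rule sum.over_tagged_division_lemma[OF tagged_partial_division_of_Union_self[OF Bpart]])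
        (simp add: content_eq_0_interior)
    also have "\<dots> = (\<Sum>K\<in>Q. dist (g (Inf K)) (g (Sup K)))"
      unfolding Q_def using B by (intro sum.mono_neutral_cong_right) auto
    also have "\<dots> = (\<Sum>(l, r)\<in>J. dist (g l) (g r))"
      by (simp add: sumJ)
    finally show ?thesis using J by simp
  qed
  have goodsum: "(\<Sum>(t, K)\<in>p - B. g (Sup K) - g (Inf K)) \<le> (\<Sum>(t, K)\<in>p - B. (M + e) * measure lborel K)"
  proof (rule sum_mono, clarify)
    fix t K assume tK: "(t, K) \<in> p" "(t, K) \<notin> B"
    then have "t \<notin> N" "t \<in> K" "K \<subseteq> {a..b}" "K \<subseteq> \<gamma> t"
      using pD(2,3)[OF tK(1)] fineD[OF fine tK(1)] tK by (auto simp: B_def)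
    then have "t \<in> {a..b}" "K \<subseteq> {a..b} \<inter> ball t (\<delta> t)"
      by (auto simp: \<gamma>_def split: if_splits)
    then show "g (Sup K) - g (Inf K) \<le> (M + e) * measure lborel K"
      using \<delta> \<open>t \<notin> N\<close> \<open>t \<in> K\<close> K[OF tK(1)] by metis
  qed
  show "g b - g a \<le> M * (b - a) + e'"
  proof -
    let ?c = "\<Sum>(t, K)\<in>B. measure lborel K"
    have "?c \<ge> 0"
      by (intro sum_nonneg) auto
    have "(\<Sum>(t, K)\<in>p. measure lborel K) = b - a"
      using additive_content_tagged_division[of p a b] p \<open>a \<le> b\<close> by simp
    then have cg: "(\<Sum>(t, K)\<in>p - B. measure lborel K) = (b - a) - ?c"
      using sum.subset_diff[OF B(1) pD(1), of "\<lambda>(t, K). measure lborel K"] by simp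
    have "g b - g a = (\<Sum>(t, K)\<in>p. g (Sup K) - g (Inf K))"
      using additive_tagged_division_1[OF \<open>a \<le> b\<close> p, of g] by simp
    also have "\<dots> = (\<Sum>(t, K)\<in>p - B. g (Sup K) - g (Inf K)) + (\<Sum>(t, K)\<in>B. g (Sup K) - g (Inf K))"
      by (rule sum.subset_diff[OF B(1) pD(1)])
    also have "\<dots> \<le> (\<Sum>(t, K)\<in>p - B. (M + e) * measure lborel K) + e"
      by (intro add_mono goodsum bad)
    also have "(\<Sum>(t, K)\<in>p - B. (M + e) * measure lborel K) = (M + e) * ((b - a) - ?c)"
      unfolding cg[symmetric] by (simp add: sum_distrib_left case_prod_unfold)
    also have "(M + e) * ((b - a) - ?c) \<le> (M + e) * (b - a) + e"
    proof -
      have "- (M + e) * ?c \<le> \<bar>M\<bar> * ?c"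
        using e(2) \<open>?c \<ge> 0\<close> by (intro mult_right_mono) auto
      also have "\<dots> \<le> \<bar>M\<bar> * d"
        using contentB by (intro mult_left_mono) auto
      finally show ?thesis
        using Md by (simp add: algebra_simps)
    qed
    finally show ?thesis
      using e(1) by (simp add: algebra_simps)
  qed
qed

text \<open>Reduction to the scalar case: test \<open>f\<close> against its own increment
  \<open>w\<close>, then cancel one factor \<open>norm w\<close>.\<close>

lemma absolutely_continuous_on_norm_increment_le:
  fixes f :: "real \<Rightarrow> 'a::real_inner"
  assumes "a \<le> b" and "K \<ge> 0" and ac: "absolutely_continuous_on {a..b} f"
    and ae: "AE t in lebesgue. t \<in> {a..b} \<longrightarrow>
      (\<exists>D. norm D \<le> K \<and> (f has_vector_derivative D) (at t within {a..b}))"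
  shows "norm (f b - f a) \<le> K * (b - a)"
proof (cases "f b = f a")
  case True
  with assms(1,2) show ?thesis by simp
next
  case False
  define w where "w = f b - f a"
  have "w \<bullet> f b - w \<bullet> f a \<le> (norm w * K) * (b - a)"
  proof (rule absolutely_continuous_on_increment_le[OF \<open>a \<le> b\<close>])
    show "absolutely_continuous_on {a..b} (\<lambda>t. w \<bullet> f t)"
    proof (rule absolutely_continuous_on_lipschitz_comp[OF ac])
      show "dist (w \<bullet> f s) (w \<bullet> f t) \<le> norm w * dist (f s) (f t)" for s t
        unfolding dist_norm using Cauchy_Schwarz_ineq2[of w "f s - f t"]
        by (simp add: inner_diff_right)
    qed
    show "AE t in lebesgue. t \<in> {a..b} \<longrightarrow>
      (\<exists>D\<le>norm w * K. ((\<lambda>t. w \<bullet> f t) has_vector_derivative D) (at t within {a..b}))"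
      using ae
    proof eventually_elim
      case (elim t)
      show ?case
      proof
        assume "t \<in> {a..b}"
        then obtain D where D: "norm D \<le> K" "(f has_vector_derivative D) (at t within {a..b})"
          using elim by blast
        have "w \<bullet> D \<le> norm w * K"
          using D(1) norm_cauchy_schwarz[of w D] mult_left_mono[of "norm D" K "norm w"] by simp
        then show "\<exists>D\<le>norm w * K. ((\<lambda>t. w \<bullet> f t) has_vector_derivative D) (at t within {a..b})"
          using bounded_linear.has_vector_derivative[OF bounded_linear_inner_right D(2)] by blast
      qed
    qed
  qed
  then have "norm w * norm w \<le> norm w * (K * (b - a))"
    by (simp add: w_def power2_norm_eq_inner[symmetric] power2_eq_square mult.assoc
        flip: inner_diff_right)
  then show ?thesis
    using False by (simp add: w_def)
qed

subsection \<open>Convergence\<close>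

text \<open>Barbalat's argument without integrals: the decay of \<open>V\<close> is only asked for
  on intervals where \<open>f\<close> keeps a fixed distance from \<open>p\<close>.\<close>

lemma dissipation_imp_tendsto:
  fixes f :: "real \<Rightarrow> 'a::metric_space" and V :: "real \<Rightarrow> real"
  assumes nonneg: "\<And>t. t \<ge> 0 \<Longrightarrow> V t \<ge> 0"
    and lip: "\<And>s t. 0 \<le> s \<Longrightarrow> s \<le> t \<Longrightarrow> dist (f t) (f s) \<le> K * (t - s)"
    and diss: "\<And>e s t. \<lbrakk>0 \<le> e; 0 \<le> s; s \<le> t; \<And>r. r \<in> {s..t} \<Longrightarrow> e \<le> dist (f r) p\<rbrakk> \<Longrightarrow>
      V t - V s \<le> - e\<^sup>2 * (t - s)"
  shows "(f \<longlongrightarrow> p) at_top"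
proof (rule tendstoI)
  fix e :: real assume "e > 0"
  \<comment> \<open>Within time \<open>\<eta>\<close> the point \<open>f\<close> moves at most
    \<open>e / 2\<close>; the summand \<open>1\<close> keeps the divisor positive.\<close>
  define \<eta> where "\<eta> = e / (2 * (\<bar>K\<bar> + 1))"
  have "\<eta> > 0"
    using \<open>e > 0\<close> by (simp add: \<eta>_def)
  have "(\<bar>K\<bar> + 1) * \<eta> = e / 2"
    by (simp add: \<eta>_def field_simps)
  then have K\<eta>: "K * h \<le> e / 2" if "0 \<le> h" "h \<le> \<eta>" for h
  proof -
    have "K * h \<le> (\<bar>K\<bar> + 1) * \<eta>"
      using that by (intro mult_mono) auto
    then show ?thesis
      using \<open>(\<bar>K\<bar> + 1) * \<eta> = e / 2\<close> by simp
  qed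
  define c where "c = (e / 2)\<^sup>2 * \<eta>"
  have "c > 0"
    using \<open>e > 0\<close> \<open>\<eta> > 0\<close> by (simp add: c_def)
  define m where "m = Inf (V ` {0..})"
  have bdd: "bdd_below (V ` {0..})"
    using nonneg by (intro bdd_belowI2[of _ 0]) auto
  \<comment> \<open>After \<open>s\<close> less than \<open>c\<close> can still be lost, and one
    excursion to distance \<open>e\<close> would cost \<open>c\<close>.\<close>
  then obtain s where s: "s \<ge> 0" "V s < m + c"
    using cInf_lessD[of "V ` {0..}" "m + c"] \<open>c > 0\<close> by (auto simp: m_def)
  have "dist (f t) p < e" if "t \<ge> s" for t
  proof (rule ccontr)
    assume far: "\<not> dist (f t) p < e"
    have "e / 2 \<le> dist (f r) p" if "r \<in> {t..t + \<eta>}" for r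
    proof -
      have "dist (f r) (f t) \<le> K * (r - t)"
        using that \<open>t \<ge> s\<close> s by (intro lip) auto
      also have "\<dots> \<le> e / 2"
        using that by (intro K\<eta>) auto
      finally show ?thesis
        using far dist_triangle[of "f t" p "f r"] by (simp add: dist_commute)
    qed
    then have "V (t + \<eta>) - V t \<le> - (e / 2)\<^sup>2 * (t + \<eta> - t)"
      using \<open>t \<ge> s\<close> s \<open>\<eta> > 0\<close> \<open>e > 0\<close> by (intro diss) auto
    \<comment> \<open>At \<open>e = 0\<close> the distance condition is trivial, so
      \<open>diss\<close> says that \<open>V\<close> never increases.\<close>
    moreover have "V t - V s \<le> 0"
      using diss[of 0 s t] s \<open>t \<ge> s\<close> by simp
    moreover have "m \<le> V (t + \<eta>)"
      unfolding m_def using \<open>t \<ge> s\<close> s \<open>\<eta> > 0\<close> by (intro cInf_lower bdd) auto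
    ultimately show False
      using s by (simp add: c_def)
  qed
  then show "\<forall>\<^sub>F t in at_top. dist (f t) p < e"
    unfolding eventually_at_top_linorder by blast
qed

theorem mainTheorem4:
  fixes P :: "real ^ 'n ^ 'n" and a :: real and b :: "real ^ 'n"
    and Xi :: "'n \<Rightarrow> real set" and X U :: "(real ^ 'n) set"
    and xs x0 u0 :: "real ^ 'n" and x u :: "real \<Rightarrow> real ^ 'n"
  assumes P_range: "\<And>i j. P $ i $ j \<in> {0..1}"
    and P_diag: "\<And>i. P $ i $ i = 0"
    and a_nonzero: "a \<noteq> 0"
    and X_def: "X = action_space Xi"
    and Xi_props: "\<And>i. Xi i \<noteq> {} \<and> closed (Xi i) \<and> convex (Xi i)"
    and U_props: "U \<noteq> {}" "closed U" "convex U" "0 \<in> U"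
    and spectral: "Max ((\<lambda>l. a * l) ` eigenvalues (P + transpose P)) < 1"
    and opt_steerable: "social_optimum P a b X \<in> steerable_set P a b X U"
    and xs_steerable: "xs \<in> steerable_set P a b X U"
    and initial: "x0 \<in> X" "u0 \<in> U" "x 0 = x0" "u 0 = u0"
    and solution: "caratheodory_solution P a b X U xs x u"
  shows "(x \<longlongrightarrow> xs) at_top"
proof -
  have "convex X"
    unfolding X_def action_space_def
  proof (rule convexI, safe)
    fix y z :: "real^'n" and v w :: real and i
    assume "\<forall>i. y $ i \<in> Xi i" "\<forall>i. z $ i \<in> Xi i" "0 \<le> v" "0 \<le> w" "v + w = 1"
    then show "(v *\<^sub>R y + w *\<^sub>R z) $ i \<in> Xi i"
      using Xi_props[of i] convexD[of "Xi i" "y $ i" "z $ i" v w] by simp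
  qed
  let ?F = "F_map P a b"
  obtain ub where "ub \<in> U" and SOL: "SOL X (\<lambda>x. ?F x - ub) = {xs}"
    using xs_steerable unfolding steerable_set_def by blast
  then have "xs \<in> X" and VI: "\<And>y. y \<in> X \<Longrightarrow> 0 \<le> (y - xs) \<bullet> (?F xs - ub)"
    unfolding SOL_def by auto
  define xd where "xd t = tangent_proj X (x t) (- ?F (x t) + u t)" for t
  define ud where "ud t = tangent_proj U (u t) (xs - x t)" for t
  have mem: "x t \<in> X" "u t \<in> U" if "t \<ge> 0" for t
    using solution that unfolding caratheodory_solution_def by blast+
  have deriv: "AE t in lebesgue. t \<ge> 0 \<longrightarrow>
      (x has_vector_derivative xd t) (at t within {0..}) \<and>
      (u has_vector_derivative ud t) (at t within {0..})"
    using solution unfolding caratheodory_solution_def xd_def ud_def by blast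
  define z where "z t = (x t, u t)" for t
  \<comment> \<open>The product metric is Euclidean, so this is the sum of the two squared
    distances; the form as one squared distance eases the proof of absolute continuity.\<close>
  define V where "V t = (dist (z t) (xs, ub))\<^sup>2" for t
  have ac: "absolutely_continuous_on {s..t} z" if "0 \<le> s" "s \<le> t" for s t
  proof (rule absolutely_continuous_on_subset[of "{0..t}"])
    show "absolutely_continuous_on {0..t} z"
      using solution that unfolding caratheodory_solution_def z_def by auto
  qed (use that in auto)

  have dissipation_rate:
    "2 * ((x t - xs) \<bullet> xd t) + 2 * ((u t - ub) \<bullet> ud t) \<le> - (dist (x t) xs)\<^sup>2" if "t \<ge> 0" for t
  proof -
    have "(x t - xs) \<bullet> xd t \<le> (x t - xs) \<bullet> (- ?F (x t) + u t)"
      unfolding xd_def using \<open>convex X\<close> \<open>xs \<in> X\<close> mem(1)[OF that] by (rule tangent_proj_obtuse)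
    moreover have "(u t - ub) \<bullet> ud t \<le> (u t - ub) \<bullet> (xs - x t)"
      unfolding ud_def using \<open>convex U\<close> \<open>ub \<in> U\<close> mem(2)[OF that] by (rule tangent_proj_obtuse)
    moreover have "(norm (x t - xs))\<^sup>2 / 2 \<le> (x t - xs) \<bullet> (?F (x t) - ?F xs)"
      using a_nonzero spectral by (rule F_map_strongly_monotone)
    moreover have "0 \<le> (x t - xs) \<bullet> (?F xs - ub)"
      using mem(1)[OF that] by (rule VI)
    \<comment> \<open>The terms pairing \<open>x t - xs\<close> with \<open>u t\<close> cancel;
      strong monotonicity and the variational inequality at \<open>xs\<close> bound the two that
      remain.\<close>
    moreover have "(x t - xs) \<bullet> (- ?F (x t) + u t) + (u t - ub) \<bullet> (xs - x t) =
        - ((x t - xs) \<bullet> (?F (x t) - ?F xs)) - (x t - xs) \<bullet> (?F xs - ub)"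
      by (simp add: inner_diff_left inner_diff_right inner_add_right inner_commute algebra_simps)
    ultimately show ?thesis
      by (simp add: dist_norm)
  qed

  have V_deriv: "AE t in lebesgue. t \<ge> 0 \<longrightarrow>
      (V has_vector_derivative 2 * ((x t - xs) \<bullet> xd t) + 2 * ((u t - ub) \<bullet> ud t)) (at t within {0..})"
    using deriv
  proof eventually_elim
    case (elim t)
    have V: "V = (\<lambda>t. (x t - xs) \<bullet> (x t - xs) + (u t - ub) \<bullet> (u t - ub))"
      by (simp add: fun_eq_iff V_def z_def dist_Pair_Pair dist_norm power2_norm_eq_inner)
    show ?case
    proof
      assume "t \<ge> 0"
      with elim have "(x has_derivative (\<lambda>h. h *\<^sub>R xd t)) (at t within {0..})"
        "(u has_derivative (\<lambda>h. h *\<^sub>R ud t)) (at t within {0..})"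
        unfolding has_vector_derivative_def by auto
      then show "(V has_vector_derivative 2 * ((x t - xs) \<bullet> xd t) + 2 * ((u t - ub) \<bullet> ud t))
          (at t within {0..})"
        unfolding V has_vector_derivative_def
        by (auto intro!: derivative_eq_intros simp: inner_commute algebra_simps)
    qed
  qed

  have dissipation: "V t - V s \<le> - e\<^sup>2 * (t - s)"
    if "0 \<le> e" "0 \<le> s" "s \<le> t" and far: "\<And>r. r \<in> {s..t} \<Longrightarrow> e \<le> dist (x r) xs" for e s t
  proof (rule absolutely_continuous_on_increment_le[OF \<open>s \<le> t\<close>])
    \<comment> \<open>A squared distance is Lipschitz only on bounded sets. No global bound is
      available yet, so compactness of this piece of the trajectory supplies one.\<close>
    have "compact (z ` {s..t})"
      using that by (intro compact_continuous_image absolutely_continuous_on_imp_continuous_on ac) auto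
    then have "bounded (z ` {s..t})"
      by (rule compact_imp_bounded)
    then obtain R where "\<forall>y\<in>z ` {s..t}. dist (xs, ub) y \<le> R"
      unfolding bounded_any_center[where a = "(xs, ub)"] by blast
    then have R: "dist (z r) (xs, ub) \<le> R" if "r \<in> {s..t}" for r
      using that by (simp add: dist_commute)
    show "absolutely_continuous_on {s..t} V"
    proof (rule absolutely_continuous_on_lipschitz_comp[OF ac])
      show "dist (V p) (V q) \<le> (2 * R) * dist (z p) (z q)" if "p \<in> {s..t}" "q \<in> {s..t}" for p q
      proof -
        let ?p = "dist (z p) (xs, ub)" and ?q = "dist (z q) (xs, ub)"
        have "dist (V p) (V q) = (?p + ?q) * \<bar>?p - ?q\<bar>"
          by (simp add: V_def dist_real_def power2_eq_square square_diff_square_factored abs_mult)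
        also have "\<dots> \<le> (2 * R) * dist (z p) (z q)"
        proof (intro mult_mono)
          show "?p + ?q \<le> 2 * R" "0 \<le> 2 * R"
            using R[OF that(1)] R[OF that(2)] zero_le_dist[of "z p" "(xs, ub)"] by linarith+
          show "\<bar>?p - ?q\<bar> \<le> dist (z p) (z q)"
            by (metis abs_dist_diff_le dist_commute)
        qed auto
        finally show ?thesis .
      qed
    qed (use that in auto)
    show "AE r in lebesgue. r \<in> {s..t} \<longrightarrow>
        (\<exists>D\<le>- e\<^sup>2. (V has_vector_derivative D) (at r within {s..t}))"
      using V_deriv
    proof eventually_elim
      case (elim r)
      show ?case
      proof
        assume r: "r \<in> {s..t}"
        then have "r \<ge> 0" using \<open>0 \<le> s\<close> by simp
        have "e\<^sup>2 \<le> (dist (x r) xs)\<^sup>2"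
          using far[OF r] \<open>0 \<le> e\<close> by (intro power_mono)
        with dissipation_rate[OF \<open>r \<ge> 0\<close>]
        have "2 * ((x r - xs) \<bullet> xd r) + 2 * ((u r - ub) \<bullet> ud r) \<le> - e\<^sup>2" by simp
        moreover have "(V has_vector_derivative 2 * ((x r - xs) \<bullet> xd r) + 2 * ((u r - ub) \<bullet> ud r))
            (at r within {s..t})"
          using elim \<open>r \<ge> 0\<close> \<open>0 \<le> s\<close> by (auto intro: has_vector_derivative_within_subset)
        ultimately show "\<exists>D\<le>- e\<^sup>2. (V has_vector_derivative D) (at r within {s..t})"
          by blast
      qed
    qed
  qed

  define R where "R = dist (z 0) (xs, ub)"
  have zR: "z t \<in> cball (xs, ub) R" if "t \<ge> 0" for t
  proof -
    have "V t \<le> V 0"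
      \<comment> \<open>With \<open>e = 0\<close>, monotonicity of \<open>V\<close> now confines the
        whole trajectory to one ball.\<close>
      using dissipation[of 0 0 t] that by simp
    then show ?thesis
      by (simp add: V_def R_def dist_commute power2_le_iff_abs_le)
  qed
  \<comment> \<open>The unprojected field is continuous, hence bounded on the ball, and projecting
    does not increase its norm: this yields the Lipschitz constant \<open>K\<close>.\<close>
  have "compact ((\<lambda>(x, u). - ?F x + u) ` cball (xs, ub) R)"
    unfolding F_map_def case_prod_unfold
    by (intro compact_continuous_image compact_cball continuous_intros
        linear_continuous_on_compose[OF _ matrix_vector_mul_linear])
  then obtain K where K: "\<And>x u. (x, u) \<in> cball (xs, ub) R \<Longrightarrow> norm (- ?F x + u) \<le> K"
    unfolding bounded_iff[of "_ ` _"] by (force dest!: compact_imp_bounded simp: bounded_iff)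
  have xdK: "norm (xd t) \<le> K" if "t \<ge> 0" for t
    unfolding xd_def
    using norm_tangent_proj_le[OF \<open>convex X\<close> mem(1)[OF that]] K[OF zR[OF that, unfolded z_def]]
    by (rule order_trans)
  have lipschitz: "dist (x t) (x s) \<le> K * (t - s)" if "0 \<le> s" "s \<le> t" for s t
    unfolding dist_norm
  proof (rule absolutely_continuous_on_norm_increment_le[OF \<open>s \<le> t\<close>])
    show "K \<ge> 0"
      using xdK[of 0] norm_ge_zero order_trans by blast
    show "absolutely_continuous_on {s..t} x"
    proof (rule absolutely_continuous_on_lipschitz_comp[OF ac])
      show "dist (x p) (x q) \<le> 1 * dist (z p) (z q)" for p q
        using dist_fst_le[of "z p" "z q"] by (simp add: z_def)
    qed (use that in auto)
    show "AE r in lebesgue. r \<in> {s..t} \<longrightarrow>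
        (\<exists>D. norm D \<le> K \<and> (x has_vector_derivative D) (at r within {s..t}))"
      using deriv
    proof eventually_elim
      case (elim r)
      show ?case
      proof
        assume r: "r \<in> {s..t}"
        then have "r \<ge> 0" using \<open>0 \<le> s\<close> by simp
        with elim \<open>0 \<le> s\<close> have "(x has_vector_derivative xd r) (at r within {s..t})"
          by (auto intro: has_vector_derivative_within_subset)
        with xdK[OF \<open>r \<ge> 0\<close>]
        show "\<exists>D. norm D \<le> K \<and> (x has_vector_derivative D) (at r within {s..t})"
          by blast
      qed
    qed
  qed
  have "V t \<ge> 0" for t
    by (simp add: V_def)
  then show ?thesis
    using lipschitz dissipation by (rule dissipation_imp_tendsto)
qed

end
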